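(* Assume the jump rates are reversible. Fix $\xi\in\mathbb R^d$ and define, for $f:\bar{\mathcal S}\to\mathbb R$, $$E_\xi(f)=\frac12\Big(A\big(\nabla f+\tfrac1{|\bar{\mathcal S}|}\xi\big),\ \nabla f+\tfrac1{|\bar{\mathcal S}|}\xi\Big).$$ Then $f^*:\bar{\mathcal S}\to\mathbb R$ minimizes the energy, $E_\xi(f^* )=\min_{f\in\mathbb R^{\bar{\mathcal S}}}E_\xi(f)$, if and only if $f^*$ is a solution of the modified unit-cell problem $$(L^Tf^* )(y)=\xi^T\sigma(y)\quad\text{for all }y\in\bar{\mathcal S}.$$
   Context: A weighted directed graph is a triple $(\mathcal S,\mathcal E,\lambda)$ with $\mathcal S\subset\mathbb R^d$ a countable set of nodes, $\mathcal E\subset\mathcal S\times\mathcal S$ the directed edges, and $\lambda:\mathcal E\to(0,\infty)$; write $\lambda_e=\lambda(e)$. Standing assumptions: the graph is strongly connected, has no edges of the form $(y,y)$, and is invariant under integer translations (for $n\in\mathbb Z^d$: $x\in\mathcal S\Rightarrow x+n\in\mathcal S$; $(x,y)\in\mathcal E\Rightarrow(x+n,y+n)\in\mathcal E$ and $\lambda(x+n,y+n)=\lambda(x,y)$). For $e=(x,y)\in\mathcal E$: $\partial_-e=x$, $\partial_+e=y$, $\nu_e=y-x$. For $y\in\mathcal S$: $\mathcal E_y=\{e\in\mathcal E:\partial_-e=y\}$, $\mathcal E'_y=\{e\in\mathcal E:\partial_+e=y\}$. $\bar{\mathcal S}$ is the quotient of $\mathcal S$ by $\mathbb Z^d$-translations,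 identified with $\mathcal S\cap[0,1)^d$. $\bar{\mathcal E}$ is the quotient of $\mathcal E$ by simultaneous translation of both endpoints by the same element of $\mathbb Z^d$, identified with $\bigcup_{y\in\bar{\mathcal S}}\mathcal E_y$. Both are assumed finite. Functions on $\bar{\mathcal S}$ (resp. $\bar{\mathcal E}$) are evaluated at nodes (resp. edges) of the full graph through their equivalence classes. Reversible rates: for every $(x,y)\in\mathcal E$, also $(y,x)\in\mathcal E$ and $\lambda(x,y)=\lambda(y,x)$ (so the generator below satisfies $L=L^T$). $(Lf)(y)=\sum_{e\in\mathcal E_y}(f(y+\nu_e)-f(y))\lambda_e$ for $f:\bar{\mathcal S}\to\mathbb R$; $L^T$ is its transpose; $\pi$ is the unique function on $\bar{\mathcal S}$ with $L^T\pi=0$, $\sum_y\pi(y)=1$; $\sigma(y)=\sum_{e\in\mathcal E'_y}\nu_e\lambda_e\pi(y-\nu_e)\in\mathbb R^d$. Gradient: $(\nabla f)(e)=(f(\partial_+e)-f(\partial_-e))\,\nu_e/|\nu_e|^2\in\mathbb R^d$ for $f:\bar{\mathcal S}\to\mathbb R$, $e\in\bar{\mathcal E}$. Local diffusivity: $A(e)=\frac12\nu_e\nu_e^T\lambda_e\in\mathbb R^{d\times d}$, and $(Ag)(e)=A(e)g(e)$ for $g:\bar{\mathcal E}\to\mathbb R^d$. A vector $\xi\in\mathbb R^d$ is also regarded as the constant edge function $e\mapsto\xi$. Inner product of $f,g:\bar{\mathcal E}\to\mathbb R^d$: $(f,g)=\sum_{e\in\bar{\mathcal E}}f(e)^Tg(e)$.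 *)

theory Defs
  imports "HOL-Analysis.Analysis"
begin

definition int_lattice :: "(real^'d) set" where
  "int_lattice = {n. \<forall>i. n $ i \<in> \<int>}"

type_synonym 'd edge = "(real^'d) \<times> (real^'d)"

definition nu :: "'d::finite edge \<Rightarrow> real^'d" where
  "nu e = snd e - fst e"

definition out_edges :: "'d::finite edge set \<Rightarrow> real^'d \<Rightarrow> 'd edge set" where
  "out_edges E y = {e \<in> E. fst e = y}"

definition in_edges :: "'d::finite edge set \<Rightarrow> real^'d \<Rightarrow> 'd edge set" where
  "in_edges E y = {e \<in> E. snd e = y}"

text \<open>The quotient of the node set by integer translations is identified with the nodes in
  \<open>[0,1)^d\<close>, and the quotient of the edge set with the edges starting at these nodes.\<close>

definition nodes_bar :: "(real^'d) set \<Rightarrow> (real^'d) set" where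
  "nodes_bar S = {y \<in> S. \<forall>i. 0 \<le> y $ i \<and> y $ i < 1}"

definition edges_bar :: "(real^'d) set \<Rightarrow> 'd::finite edge set \<Rightarrow> 'd edge set" where
  "edges_bar S E = (\<Union>y\<in>nodes_bar S. out_edges E y)"

locale periodic_weighted_graph =
  fixes S :: "(real^'d::finite) set"
    and E :: "'d edge set"
    and rate :: "'d edge \<Rightarrow> real"
  assumes countable_nodes: "countable S"
    and edges_subset: "E \<subseteq> S \<times> S"
    and rate_pos: "\<And>e. e \<in> E \<Longrightarrow> rate e > 0"
    and strongly_connected: "\<And>x y. x \<in> S \<Longrightarrow> y \<in> S \<Longrightarrow> (x, y) \<in> E\<^sup>*"
    and no_loops: "\<And>y. (y, y) \<notin> E"
    and nodes_translate: "\<And>n x. n \<in> int_lattice \<Longrightarrow> x \<in> S \<Longrightarrow> x + n \<in> S"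
    and edges_translate: "\<And>n x y. n \<in> int_lattice \<Longrightarrow> (x, y) \<in> E \<Longrightarrow> (x + n, y + n) \<in> E"
    and rate_translate: "\<And>n x y. n \<in> int_lattice \<Longrightarrow> (x, y) \<in> E \<Longrightarrow>
      rate (x + n, y + n) = rate (x, y)"
    and finite_nodes_bar: "finite (nodes_bar S)"
    and finite_edges_bar: "finite (edges_bar S E)"

definition reversible :: "'d::finite edge set \<Rightarrow> ('d edge \<Rightarrow> real) \<Rightarrow> bool" where
  "reversible E rate \<longleftrightarrow> (\<forall>x y. (x, y) \<in> E \<longrightarrow> (y, x) \<in> E \<and> rate (x, y) = rate (y, x))"

text \<open>Real functions on the quotient are the elements of \<open>extensional (nodes_bar S)\<close>.
  Such a function is evaluated at a node of the full graph through the representative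
  of its class in \<open>[0,1)^d\<close>.\<close>

definition at_node :: "(real^'d \<Rightarrow> real) \<Rightarrow> real^'d \<Rightarrow> real" where
  "at_node f y = f (\<chi> i. frac (y $ i))"

definition generator ::
    "'d::finite edge set \<Rightarrow> ('d edge \<Rightarrow> real) \<Rightarrow> (real^'d \<Rightarrow> real) \<Rightarrow> real^'d \<Rightarrow> real" where
  "generator E rate f y =
    (\<Sum>e\<in>out_edges E y. (at_node f (y + nu e) - at_node f y) * rate e)"

text \<open>The matrix entry of the generator at row \<open>z\<close> and column \<open>y\<close> is its value at \<open>z\<close> on the
  indicator function of \<open>y\<close>.\<close>

definition generator_transpose ::
    "(real^'d) set \<Rightarrow> 'd::finite edge set \<Rightarrow> ('d edge \<Rightarrow> real) \<Rightarrow>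
      (real^'d \<Rightarrow> real) \<Rightarrow> real^'d \<Rightarrow> real" where
  "generator_transpose S E rate f y =
    (\<Sum>z\<in>nodes_bar S. generator E rate (indicator {y}) z * f z)"

definition stationary ::
    "(real^'d) set \<Rightarrow> 'd::finite edge set \<Rightarrow> ('d edge \<Rightarrow> real) \<Rightarrow> real^'d \<Rightarrow> real" where
  "stationary S E rate = (THE p. p \<in> extensional (nodes_bar S) \<and>
    (\<forall>y\<in>nodes_bar S. generator_transpose S E rate p y = 0) \<and> (\<Sum>y\<in>nodes_bar S. p y) = 1)"

definition sigma_drift ::
    "(real^'d) set \<Rightarrow> 'd::finite edge set \<Rightarrow> ('d edge \<Rightarrow> real) \<Rightarrow> real^'d \<Rightarrow> real^'d" where
  "sigma_drift S E rate y =
    (\<Sum>e\<in>in_edges E y. (rate e * at_node (stationary S E rate) (y - nu e)) *\<^sub>R nu e)"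

definition grad :: "(real^'d \<Rightarrow> real) \<Rightarrow> 'd::finite edge \<Rightarrow> real^'d" where
  "grad f e = ((at_node f (snd e) - at_node f (fst e)) / (norm (nu e))\<^sup>2) *\<^sub>R nu e"

definition diffusivity :: "('d edge \<Rightarrow> real) \<Rightarrow> 'd::finite edge \<Rightarrow> real^'d^'d" where
  "diffusivity rate e = (\<chi> i j. 1/2 * (nu e $ i * nu e $ j) * rate e)"

definition edge_inner ::
    "(real^'d) set \<Rightarrow> 'd::finite edge set \<Rightarrow>
      ('d edge \<Rightarrow> real^'d) \<Rightarrow> ('d edge \<Rightarrow> real^'d) \<Rightarrow> real" where
  "edge_inner S E f g = (\<Sum>e\<in>edges_bar S E. f e \<bullet> g e)"

definition energy ::
    "(real^'d) set \<Rightarrow> 'd::finite edge set \<Rightarrow> ('d edge \<Rightarrow> real) \<Rightarrow> real^'d \<Rightarrow>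
      (real^'d \<Rightarrow> real) \<Rightarrow> real" where
  "energy S E rate \<xi> f =
    (let g = (\<lambda>e. grad f e + (1 / real (card (nodes_bar S))) *\<^sub>R \<xi>)
     in 1/2 * edge_inner S E (\<lambda>e. diffusivity rate e *v g e) g)"

end

theory Submission
  imports Defs
begin

text \<open>Since \<open>A(e) = \<nu>\<^sub>e \<nu>\<^sub>e\<^sup>T \<lambda>\<^sub>e / 2\<close> sees only the component of a field along \<open>\<nu>\<^sub>e\<close>, the
  energy is, with \<open>n\<close> the number of nodes in the unit cell, the quadratic functional
  \<open>(1/4) \<Sum>\<^sub>e \<lambda>\<^sub>e (f(\<partial>\<^sub>+e) - f(\<partial>\<^sub>-e) + \<nu>\<^sub>e \<bullet> \<xi> / n)\<^sup>2\<close> (lemma \<open>energy_eq\<close>). It is convex, so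
  its minimizers are exactly the zeros of its first variation.

  Reversing an edge, and translating the result back so that it starts in the unit cell, is an
  involution on the edge classes. It preserves the rates and changes the sign of \<open>\<nu>\<^sub>e\<close>
  and of the difference of \<open>f\<close> along \<open>e\<close>. For a field \<open>G\<close> that is odd under this
  involution, pairing \<open>e\<close> with its reverse gives the summation by parts formula
  \<open>\<Sum>\<^sub>e \<lambda>\<^sub>e G(e) (h(\<partial>\<^sub>+e) - h(\<partial>\<^sub>-e)) = -2 \<Sum>\<^sub>y h(y) \<Sum>\<^bsub>e \<in> E\<^sub>y\<^esub> \<lambda>\<^sub>e G(e)\<close>
  (lemma \<open>summation_by_parts\<close>). It has three uses.
  It shows that the generator is symmetric.
  Applied to a harmonic function paired with itself, and combined with strong connectedness, it
  shows that harmonic functions are constant, so that the stationary distribution is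
  \<open>1/n\<close> and \<open>\<sigma>(y) = -(1/n) \<Sum>\<^bsub>e \<in> E\<^sub>y\<^esub> \<lambda>\<^sub>e \<nu>\<^sub>e\<close>.
  Applied to \<open>G(e) = f(\<partial>\<^sub>+e) - f(\<partial>\<^sub>-e) + \<nu>\<^sub>e \<bullet> \<xi> / n\<close>, it identifies the first variation of
  the energy in the direction \<open>h\<close> as
  \<open>-\<Sum>\<^sub>y h(y) (L\<^sup>T f (y) - \<xi> \<bullet> \<sigma>(y))\<close>, which vanishes for all \<open>h\<close> exactly when \<open>f\<close> solves the
  unit-cell problem.\<close>

section \<open>Translation into the unit cell\<close>

definition floor_vec :: "real^'d::finite \<Rightarrow> real^'d" where
  "floor_vec y = (\<chi> i. of_int \<lfloor>y $ i\<rfloor>)"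

lemma floor_vec_in_int_lattice: "floor_vec y \<in> int_lattice"
  by (simp add: floor_vec_def int_lattice_def)

lemma uminus_in_int_lattice: "n \<in> int_lattice \<Longrightarrow> - n \<in> int_lattice"
  by (simp add: int_lattice_def)

lemma at_node_eq: "at_node f y = f (y - floor_vec y)"
  by (simp add: at_node_def floor_vec_def frac_def minus_vec_def)

lemma at_node_translate:
  assumes "n \<in> int_lattice"
  shows "at_node f (y + n) = at_node f y"
proof -
  have "frac ((y + n) $ i) = frac (y $ i)" for i
    using assms by (auto simp: int_lattice_def frac_def elim!: Ints_cases[of "n $ i" for i])
  then show ?thesis
    by (simp add: at_node_def)
qed

lemma at_node_translate_back:
  "n \<in> int_lattice \<Longrightarrow> at_node f (y - n) = at_node f y"
  using at_node_translate[of "- n" f y] uminus_in_int_lattice[of n] by simp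

lemma at_node_nodes_bar: "y \<in> nodes_bar S \<Longrightarrow> at_node f y = f y"
proof -
  assume "y \<in> nodes_bar S"
  then have "(\<chi> i. frac (y $ i)) = y"
    by (simp add: nodes_bar_def vec_eq_iff frac_eq)
  then show ?thesis
    by (simp add: at_node_def)
qed

lemma floor_vec_nodes_bar: "y \<in> nodes_bar S \<Longrightarrow> floor_vec y = 0"
  by (auto simp: nodes_bar_def floor_vec_def vec_eq_iff floor_eq_iff)

lemma floor_vec_translate_back:
  assumes "n \<in> int_lattice"
  shows "floor_vec (y - n) = floor_vec y - n"
proof -
  have "real_of_int \<lfloor>y $ i - n $ i\<rfloor> = of_int \<lfloor>y $ i\<rfloor> - n $ i" for i
  proof -
    obtain k where "n $ i = of_int k"
      using assms by (auto simp: int_lattice_def elim: Ints_cases)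
    then show ?thesis by simp
  qed
  then show ?thesis
    by (simp add: floor_vec_def vec_eq_iff)
qed

definition edge_diff :: "(real^'d \<Rightarrow> real) \<Rightarrow> 'd::finite edge \<Rightarrow> real" where
  "edge_diff f e = at_node f (snd e) - at_node f (fst e)"

text \<open>The opposite edge of \<open>e\<close> starts at \<open>\<partial>\<^sub>+e\<close>, which may lie outside the unit cell; it is
  represented by its translate that starts in the cell.\<close>

definition edge_reversal :: "'d::finite edge \<Rightarrow> 'd edge" where
  "edge_reversal e = (snd e - floor_vec (snd e), fst e - floor_vec (snd e))"

lemma nu_edge_reversal: "nu (edge_reversal e) = - nu e"
  by (simp add: edge_reversal_def nu_def)

lemma at_node_edge_reversal:
  "at_node f (fst (edge_reversal e)) = at_node f (snd e)"
  "at_node f (snd (edge_reversal e)) = at_node f (fst e)"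
  by (simp_all add: edge_reversal_def at_node_translate_back floor_vec_in_int_lattice)

lemma edge_diff_edge_reversal: "edge_diff f (edge_reversal e) = - edge_diff f e"
  by (simp add: edge_diff_def at_node_edge_reversal)

lemma edge_diff_add_scale:
  "edge_diff (\<lambda>y. f y + t * h y) e = edge_diff f e + t * edge_diff h e"
  by (simp add: edge_diff_def at_node_def algebra_simps)

section \<open>The quotient graph\<close>

context periodic_weighted_graph
begin

lemma node_in_nodes_bar:
  assumes "y \<in> S"
  shows "y - floor_vec y \<in> nodes_bar S"
proof -
  have "y + - floor_vec y \<in> S"
    by (intro nodes_translate uminus_in_int_lattice floor_vec_in_int_lattice assms)
  moreover have "0 \<le> (y - floor_vec y) $ i \<and> (y - floor_vec y) $ i < 1" for i
    using frac_ge_0[of "y $ i"] frac_lt_1[of "y $ i"] by (simp add: floor_vec_def frac_def)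
  ultimately show ?thesis
    by (simp add: nodes_bar_def)
qed

lemma edges_barE:
  assumes "e \<in> edges_bar S E"
  shows "e \<in> E" "fst e \<in> nodes_bar S" "snd e \<in> S"
  using assms edges_subset by (auto simp: edges_bar_def out_edges_def)

lemma sum_edges_bar:
  "(\<Sum>e\<in>edges_bar S E. F e) = (\<Sum>y\<in>nodes_bar S. \<Sum>e\<in>out_edges E y. F e)"
  unfolding edges_bar_def
proof (rule sum.UNION_disjoint)
  show "\<forall>y\<in>nodes_bar S. finite (out_edges E y)"
    using finite_edges_bar by (auto simp: edges_bar_def intro: finite_subset)
qed (use finite_nodes_bar in \<open>auto simp: out_edges_def\<close>)

lemma sum_indicator_node:
  fixes F :: "real^'d \<Rightarrow> real"
  assumes "y \<in> nodes_bar S"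
  shows "(\<Sum>z\<in>nodes_bar S. indicator {y} z * F z) = F y"
proof -
  have "(\<Sum>z\<in>nodes_bar S. indicator {y} z * F z) = (\<Sum>z\<in>nodes_bar S. if z = y then F z else 0)"
    by (intro sum.cong refl) simp
  then show ?thesis
    using assms finite_nodes_bar by simp
qed

text \<open>Functions are extensional on the unit cell, while the sums only see the values there.\<close>

lemma edge_diff_restrict:
  assumes "e \<in> edges_bar S E"
  shows "edge_diff (restrict f (nodes_bar S)) e = edge_diff f e"
  using edges_barE[OF assms] node_in_nodes_bar
  by (simp add: edge_diff_def at_node_nodes_bar) (simp add: at_node_eq)

lemma generator_eq: "generator E rate f y = (\<Sum>e\<in>out_edges E y. rate e * edge_diff f e)"
  unfolding generator_def
  by (rule sum.cong) (auto simp: out_edges_def nu_def edge_diff_def)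

text \<open>\<open>A(e)\<close> has rank one, so only \<open>\<nu>\<^sub>e \<bullet> g(e)\<close> contributes to the energy; for the gradient,
  the factor \<open>|\<nu>\<^sub>e|\<^sup>2\<close> cancels because loops are excluded.\<close>

lemma energy_eq:
  "energy S E rate \<xi> f =
    1/4 * (\<Sum>e\<in>edges_bar S E. rate e * (edge_diff f e + nu e \<bullet> \<xi> / card (nodes_bar S))\<^sup>2)"
proof -
  have rank_one: "(diffusivity rate e *v g) \<bullet> g = 1/2 * (rate e * (nu e \<bullet> g)\<^sup>2)" for e g
  proof -
    have "diffusivity rate e *v g = (1/2 * rate e * (nu e \<bullet> g)) *\<^sub>R nu e"
      by (simp add: diffusivity_def matrix_vector_mult_def vec_eq_iff inner_vec_def
          sum_distrib_left sum_distrib_right mult_ac)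
    then show ?thesis
      by (simp add: power2_eq_square)
  qed
  have component: "nu e \<bullet> (grad f e + (1 / card (nodes_bar S)) *\<^sub>R \<xi>)
      = edge_diff f e + nu e \<bullet> \<xi> / card (nodes_bar S)" if "e \<in> edges_bar S E" for e
  proof -
    have "nu e \<noteq> 0"
      using edges_barE(1)[OF that] no_loops by (cases e) (auto simp: nu_def)
    then show ?thesis
      by (simp add: grad_def edge_diff_def inner_add_right power2_norm_eq_inner)
  qed
  show ?thesis
    by (simp add: energy_def Let_def edge_inner_def rank_one component sum_distrib_left
        cong: sum.cong)
qed

text \<open>Strong connectedness refers to the full graph, whereas the differences are controlled on
  the edges that start in the unit cell. Translating an edge there preserves the
  values of a periodic function at its endpoints.\<close>

lemma constant_if_edge_diff_zero:
  assumes zero: "\<And>e. e \<in> edges_bar S E \<Longrightarrow> edge_diff f e = 0"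
    and "x \<in> nodes_bar S" "y \<in> nodes_bar S"
  shows "f x = f y"
proof -
  have step: "at_node f a = at_node f b" if "(a, b) \<in> E" for a b
  proof -
    let ?e = "(a - floor_vec a, b - floor_vec a)"
    have "(a + - floor_vec a, b + - floor_vec a) \<in> E"
      by (intro edges_translate uminus_in_int_lattice floor_vec_in_int_lattice that)
    moreover have "a \<in> S"
      using that edges_subset by auto
    ultimately have "?e \<in> edges_bar S E"
      using node_in_nodes_bar by (auto simp: edges_bar_def out_edges_def)
    from zero[OF this] show ?thesis
      by (simp add: edge_diff_def at_node_translate_back floor_vec_in_int_lattice)
  qed
  have "(x, y) \<in> E\<^sup>*"
    using assms(2,3) by (intro strongly_connected) (auto simp: nodes_bar_def)
  then have "at_node f x = at_node f y"
    by (induction rule: rtrancl_induct) (auto dest: step)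
  then show ?thesis
    using assms(2,3) by (simp add: at_node_nodes_bar)
qed

end

section \<open>Reversible rates\<close>

locale reversible_graph = periodic_weighted_graph +
  assumes reversible: "reversible E rate"
begin

lemma edge_reversal_in_edges_bar:
  assumes "e \<in> edges_bar S E"
  shows "edge_reversal e \<in> edges_bar S E" "rate (edge_reversal e) = rate e"
proof -
  obtain x y where e: "e = (x, y)"
    by (cases e)
  have yx: "(y, x) \<in> E" and rate: "rate (y, x) = rate (x, y)"
    using edges_barE(1)[OF assms] reversible by (auto simp: e reversible_def)
  have n: "- floor_vec y \<in> int_lattice"
    by (intro uminus_in_int_lattice floor_vec_in_int_lattice)
  show "edge_reversal e \<in> edges_bar S E"
    using edges_translate[OF n yx] node_in_nodes_bar[OF edges_barE(3)[OF assms]]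
    by (simp add: edges_bar_def out_edges_def edge_reversal_def e)
  show "rate (edge_reversal e) = rate e"
    using rate_translate[OF n yx] rate by (simp add: edge_reversal_def e)
qed

lemma edge_reversal_involution:
  assumes "e \<in> edges_bar S E"
  shows "edge_reversal (edge_reversal e) = e"
  using floor_vec_nodes_bar[OF edges_barE(2)[OF assms]]
  by (simp add: edge_reversal_def floor_vec_translate_back floor_vec_in_int_lattice)

lemma sum_edge_reversal:
  "(\<Sum>e\<in>edges_bar S E. F (edge_reversal e)) = (\<Sum>e\<in>edges_bar S E. F e)"
  by (rule sum.reindex_bij_witness[where i = edge_reversal and j = edge_reversal])
    (auto simp: edge_reversal_involution edge_reversal_in_edges_bar)

text \<open>Each difference of \<open>h\<close> has a term at the head and a term at the tail of \<open>e\<close>. Reversing the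
  edges turns the head terms into tail terms; the sign from the oddness of \<open>G\<close> makes the
  two sums add up instead of cancelling.\<close>

lemma summation_by_parts:
  assumes odd: "\<And>e. e \<in> edges_bar S E \<Longrightarrow> G (edge_reversal e) = - G e"
  shows "(\<Sum>e\<in>edges_bar S E. rate e * G e * edge_diff h e)
    = - 2 * (\<Sum>y\<in>nodes_bar S. h y * (\<Sum>e\<in>out_edges E y. rate e * G e))"
proof -
  have "(\<Sum>e\<in>edges_bar S E. rate e * G e * at_node h (snd e))
      = (\<Sum>e\<in>edges_bar S E. rate (edge_reversal e) * - G (edge_reversal e)
          * at_node h (fst (edge_reversal e)))"
    by (rule sum.cong) (auto simp: edge_reversal_in_edges_bar at_node_edge_reversal odd)
  also have "\<dots> = (\<Sum>e\<in>edges_bar S E. rate e * - G e * at_node h (fst e))"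
    by (rule sum_edge_reversal)
  finally have head: "(\<Sum>e\<in>edges_bar S E. rate e * G e * at_node h (snd e))
      = - (\<Sum>e\<in>edges_bar S E. rate e * G e * at_node h (fst e))"
    by (simp add: sum_negf)
  have "(\<Sum>e\<in>edges_bar S E. rate e * G e * at_node h (fst e))
      = (\<Sum>y\<in>nodes_bar S. h y * (\<Sum>e\<in>out_edges E y. rate e * G e))"
    unfolding sum_edges_bar sum_distrib_left
    by (intro sum.cong refl) (auto simp: out_edges_def at_node_nodes_bar mult_ac)
  with head show ?thesis
    by (simp add: edge_diff_def right_diff_distrib sum_subtractf)
qed

lemma dirichlet_form:
  "(\<Sum>e\<in>edges_bar S E. rate e * edge_diff f e * edge_diff h e)
    = - 2 * (\<Sum>y\<in>nodes_bar S. h y * generator E rate f y)"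
  using summation_by_parts[of "edge_diff f" h] by (simp add: edge_diff_edge_reversal generator_eq)

text \<open>The pairing of \<open>L h\<close> with \<open>f\<close> is minus one half of the Dirichlet form, which is symmetric
  in \<open>f\<close> and \<open>h\<close>; taking \<open>h\<close> to be an indicator extracts one entry of \<open>L\<^sup>T f\<close>.\<close>

lemma generator_symmetric:
  assumes "y \<in> nodes_bar S"
  shows "generator_transpose S E rate f y = generator E rate f y"
proof -
  let ?h = "indicator {y} :: real^'a \<Rightarrow> real"
  have "(\<Sum>z\<in>nodes_bar S. f z * generator E rate ?h z)
      = (\<Sum>z\<in>nodes_bar S. ?h z * generator E rate f z)"
    using dirichlet_form[of f ?h] dirichlet_form[of ?h f] by (simp add: mult_ac)
  also have "\<dots> = generator E rate f y"
    using assms by (rule sum_indicator_node)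
  finally show ?thesis
    by (simp add: generator_transpose_def mult.commute)
qed

text \<open>The Dirichlet form of a harmonic function with itself vanishes, and it is a sum of squares
  with positive weights.\<close>

lemma harmonic_imp_constant:
  assumes harmonic: "\<And>y. y \<in> nodes_bar S \<Longrightarrow> generator E rate f y = 0"
    and "x \<in> nodes_bar S" "y \<in> nodes_bar S"
  shows "f x = f y"
proof (rule constant_if_edge_diff_zero[OF _ assms(2,3)])
  have "(\<Sum>e\<in>edges_bar S E. rate e * (edge_diff f e)\<^sup>2) = 0"
    using dirichlet_form[of f f] harmonic by (simp add: power2_eq_square mult_ac)
  moreover have pos: "rate e > 0" if "e \<in> edges_bar S E" for e
    using rate_pos edges_barE(1)[OF that] by simp
  ultimately have "\<forall>e\<in>edges_bar S E. rate e * (edge_diff f e)\<^sup>2 = 0"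
    by (subst (asm) sum_nonneg_eq_0_iff) (auto intro: finite_edges_bar mult_nonneg_nonneg[OF less_imp_le[OF pos]])
  then show "edge_diff f e = 0" if "e \<in> edges_bar S E" for e
    using that pos[OF that] by auto
qed

lemma stationary_eq:
  assumes "nodes_bar S \<noteq> {}"
  shows "stationary S E rate = (\<lambda>y\<in>nodes_bar S. 1 / card (nodes_bar S))"
  unfolding stationary_def
proof (rule the_equality)
  let ?p = "\<lambda>y\<in>nodes_bar S. 1 / real (card (nodes_bar S))"
  have card: "card (nodes_bar S) \<noteq> 0"
    using assms finite_nodes_bar by simp
  have "generator E rate ?p y = 0" if "y \<in> nodes_bar S" for y
  proof -
    have "edge_diff ?p e = 0" if "e \<in> out_edges E y" for e
    proof -
      have "e \<in> edges_bar S E"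
        using that \<open>y \<in> nodes_bar S\<close> by (auto simp: edges_bar_def)
      then show ?thesis
        by (subst edge_diff_restrict) (auto simp: edge_diff_def at_node_def)
    qed
    then show ?thesis
      by (simp add: generator_eq)
  qed
  then show "?p \<in> extensional (nodes_bar S) \<and>
      (\<forall>y\<in>nodes_bar S. generator_transpose S E rate ?p y = 0) \<and> (\<Sum>y\<in>nodes_bar S. ?p y) = 1"
    using card by (simp add: generator_symmetric)
  fix p
  assume p: "p \<in> extensional (nodes_bar S) \<and>
      (\<forall>y\<in>nodes_bar S. generator_transpose S E rate p y = 0) \<and> (\<Sum>y\<in>nodes_bar S. p y) = 1"
  then have const: "p x = p y" if "x \<in> nodes_bar S" "y \<in> nodes_bar S" for x y
    using harmonic_imp_constant[OF _ that] by (simp add: generator_symmetric)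
  show "p = ?p"
  proof (rule extensionalityI[of _ "nodes_bar S"])
    fix y
    assume y: "y \<in> nodes_bar S"
    have "1 = (\<Sum>x\<in>nodes_bar S. p x)"
      using p by simp
    also have "\<dots> = (\<Sum>x\<in>nodes_bar S. p y)"
      by (intro sum.cong refl const y)
    finally show "p y = ?p y"
      using y card by (simp add: field_simps)
  qed (use p in auto)
qed

text \<open>Reversibility turns incoming into outgoing edges, with the opposite displacement.\<close>

lemma sigma_drift_eq:
  assumes y: "y \<in> nodes_bar S"
  shows "sigma_drift S E rate y
    = - (\<Sum>e\<in>out_edges E y. (rate e / card (nodes_bar S)) *\<^sub>R nu e)"
proof -
  have uniform: "at_node (stationary S E rate) x = 1 / card (nodes_bar S)" if "x \<in> S" for x
    using y node_in_nodes_bar[OF that] by (subst stationary_eq) (auto simp: at_node_eq)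
  have "sigma_drift S E rate y
      = (\<Sum>e\<in>in_edges E y. (rate e * (1 / card (nodes_bar S))) *\<^sub>R nu e)"
    unfolding sigma_drift_def using edges_subset
    by (intro sum.cong refl) (auto simp: in_edges_def nu_def uniform)
  also have "\<dots> = (\<Sum>e\<in>out_edges E y. - ((rate e / card (nodes_bar S)) *\<^sub>R nu e))"
    using reversible
    by (intro sum.reindex_bij_witness[where i = prod.swap and j = prod.swap])
      (auto simp: in_edges_def out_edges_def reversible_def nu_def algebra_simps)
  finally show ?thesis
    by (simp add: sum_negf)
qed

section \<open>Minimizers of the energy\<close>

text \<open>The negative of the residual is the gradient of the energy with respect to the values of
  \<open>f\<close>, see \<open>energy_expansion\<close>.\<close>

definition cell_residual :: "real^'a \<Rightarrow> (real^'a \<Rightarrow> real) \<Rightarrow> real^'a \<Rightarrow> real" where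
  "cell_residual \<xi> f y = generator_transpose S E rate f y - \<xi> \<bullet> sigma_drift S E rate y"

lemma cell_residual_eq:
  assumes "y \<in> nodes_bar S"
  shows "cell_residual \<xi> f y
    = (\<Sum>e\<in>out_edges E y. rate e * (edge_diff f e + nu e \<bullet> \<xi> / card (nodes_bar S)))"
  by (simp add: cell_residual_def generator_symmetric sigma_drift_eq assms generator_eq
      inner_sum_right distrib_left sum.distrib inner_commute)

lemma energy_restrict: "energy S E rate \<xi> (restrict f (nodes_bar S)) = energy S E rate \<xi> f"
  by (simp add: energy_eq edge_diff_restrict cong: sum.cong)

text \<open>The field \<open>G\<close> in the linear term is odd because \<open>\<nu>\<^sub>e\<close> and the difference of \<open>f\<close> both change
  sign under reversal; summation by parts then moves the differences off \<open>h\<close>. The quadratic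
  term does not depend on \<open>f\<close> and is nonnegative.\<close>

lemma energy_expansion:
  "energy S E rate \<xi> (\<lambda>y. f y + t * h y) = energy S E rate \<xi> f
    - t * (\<Sum>y\<in>nodes_bar S. h y * cell_residual \<xi> f y)
    + t\<^sup>2 * (1/4 * (\<Sum>e\<in>edges_bar S E. rate e * (edge_diff h e)\<^sup>2))"
proof -
  define G where "G e = edge_diff f e + nu e \<bullet> \<xi> / card (nodes_bar S)" for e
  have G_odd: "G (edge_reversal e) = - G e" for e
    by (simp add: G_def edge_diff_edge_reversal nu_edge_reversal)
  have first_variation: "(\<Sum>e\<in>edges_bar S E. rate e * G e * edge_diff h e)
      = - 2 * (\<Sum>y\<in>nodes_bar S. h y * cell_residual \<xi> f y)"
    by (subst summation_by_parts[of G, OF G_odd]) (simp add: cell_residual_eq G_def cong: sum.cong)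
  have "(\<Sum>e\<in>edges_bar S E. rate e * (G e + t * edge_diff h e)\<^sup>2)
      = (\<Sum>e\<in>edges_bar S E. rate e * (G e)\<^sup>2 + 2 * t * (rate e * G e * edge_diff h e)
          + t\<^sup>2 * (rate e * (edge_diff h e)\<^sup>2))"
    by (intro sum.cong refl) (simp add: power2_eq_square algebra_simps)
  also have "\<dots> = (\<Sum>e\<in>edges_bar S E. rate e * (G e)\<^sup>2)
      + 2 * t * (\<Sum>e\<in>edges_bar S E. rate e * G e * edge_diff h e)
      + t\<^sup>2 * (\<Sum>e\<in>edges_bar S E. rate e * (edge_diff h e)\<^sup>2)"
    by (simp add: sum.distrib sum_distrib_left)
  finally have expand: "(\<Sum>e\<in>edges_bar S E. rate e * (G e + t * edge_diff h e)\<^sup>2) = \<dots>" .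
  have "energy S E rate \<xi> f = 1/4 * (\<Sum>e\<in>edges_bar S E. rate e * (G e)\<^sup>2)"
    by (simp add: energy_eq G_def)
  moreover have "energy S E rate \<xi> (\<lambda>y. f y + t * h y)
      = 1/4 * (\<Sum>e\<in>edges_bar S E. rate e * (G e + t * edge_diff h e)\<^sup>2)"
    by (simp add: energy_eq edge_diff_add_scale G_def add_ac)
  ultimately show ?thesis
    unfolding expand first_variation by (simp add: field_simps)
qed

lemma energy_minimizer_iff:
  assumes f: "f \<in> extensional (nodes_bar S)"
  shows "is_arg_min (energy S E rate \<xi>) (\<lambda>g. g \<in> extensional (nodes_bar S)) f
    \<longleftrightarrow> (\<forall>y\<in>nodes_bar S. cell_residual \<xi> f y = 0)"
proof
  assume residual: "\<forall>y\<in>nodes_bar S. cell_residual \<xi> f y = 0"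
  have "energy S E rate \<xi> f \<le> energy S E rate \<xi> g" for g
  proof -
    have "0 \<le> (\<Sum>e\<in>edges_bar S E. rate e * (edge_diff (\<lambda>y. g y - f y) e)\<^sup>2)"
      using rate_pos edges_barE(1) by (intro sum_nonneg mult_nonneg_nonneg) (auto intro: less_imp_le)
    then show ?thesis
      using energy_expansion[of \<xi> f 1 "\<lambda>y. g y - f y"] residual by simp
  qed
  with f show "is_arg_min (energy S E rate \<xi>) (\<lambda>g. g \<in> extensional (nodes_bar S)) f"
    by (auto simp: is_arg_min_linorder)
next
  assume min: "is_arg_min (energy S E rate \<xi>) (\<lambda>g. g \<in> extensional (nodes_bar S)) f"
  show "\<forall>y\<in>nodes_bar S. cell_residual \<xi> f y = 0"
  proof
    fix y
    assume y: "y \<in> nodes_bar S"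
    \<comment> \<open>Varying only the value at \<open>y\<close> isolates the residual at \<open>y\<close>.\<close>
    let ?h = "indicator {y} :: real^'a \<Rightarrow> real"
    define r where "r = cell_residual \<xi> f y"
    define q where "q = 1/4 * (\<Sum>e\<in>edges_bar S E. rate e * (edge_diff ?h e)\<^sup>2)"
    have r: "(\<Sum>z\<in>nodes_bar S. ?h z * cell_residual \<xi> f z) = r"
      unfolding r_def using y by (rule sum_indicator_node)
    have parabola: "0 \<le> t\<^sup>2 * q - t * r" for t
    proof -
      have "energy S E rate \<xi> f
          \<le> energy S E rate \<xi> (restrict (\<lambda>z. f z + t * ?h z) (nodes_bar S))"
        using min by (auto simp: is_arg_min_linorder)
      then show ?thesis
        unfolding energy_restrict energy_expansion r q_def by simp
    qed
    have "q \<ge> 0"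
      using rate_pos edges_barE(1) unfolding q_def
      by (intro mult_nonneg_nonneg sum_nonneg) (auto intro: less_imp_le)
    \<comment> \<open>The parabola is negative at \<open>t = r / (q + 1)\<close> unless \<open>r = 0\<close>; the summand 1 covers \<open>q = 0\<close>.\<close>
    define s where "s = r / (q + 1)"
    have r_eq: "r = s * (q + 1)"
      using \<open>q \<ge> 0\<close> by (simp add: s_def)
    have "s\<^sup>2 * q - s * r = - s\<^sup>2"
      by (simp add: r_eq power2_eq_square algebra_simps)
    with parabola[of s] have "s = 0"
      by simp
    then show "cell_residual \<xi> f y = 0"
      using r_eq by (simp add: r_def)
  qed
qed

end

theorem theorem6p6:
  fixes S :: "(real^'d::finite) set"
    and E :: "'d edge set"
    and rate :: "'d edge \<Rightarrow> real"
    and \<xi> :: "real^'d"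
    and fstar :: "real^'d \<Rightarrow> real"
  assumes "periodic_weighted_graph S E rate"
    and "reversible E rate"
    and "fstar \<in> extensional (nodes_bar S)"
  shows "is_arg_min (energy S E rate \<xi>) (\<lambda>f. f \<in> extensional (nodes_bar S)) fstar \<longleftrightarrow>
    (\<forall>y\<in>nodes_bar S. generator_transpose S E rate fstar y = \<xi> \<bullet> sigma_drift S E rate y)"
proof -
  interpret reversible_graph S E rate
    using assms(1,2) by (simp add: reversible_graph_def reversible_graph_axioms_def)
  show ?thesis
    using energy_minimizer_iff[OF assms(3)] by (simp add: cell_residual_def)
qed

end
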